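(* Let $\{B_n(x)\}_{n=0}^\infty$ be a sequence in $\mathbb{R}[x]$ with $\deg(B_n(x))=n$ for every $n\in\mathbb{N}_0$ (and $B_0(x)\not\equiv 0$). Suppose there is a finite order differential operator $W$ such that $W[B_n(x)]=nB_n(x)$ for every $n\in\mathbb{N}_0$. Let $\{a_n\}_{n=0}^\infty$ be a sequence of real numbers and $\{Q_k(x)\}_{k=0}^\infty$ a sequence in $\mathbb{R}[x]$ such that the linear operator $T=\sum_{k=0}^\infty Q_k(x)D^k:\mathbb{R}[x]\to\mathbb{R}[x]$ satisfies $$T[B_n(x)]=\left(\sum_{k=0}^\infty Q_k(x)D^k\right)B_n(x)=a_nB_n(x)\quad\text{for every } n\in\mathbb{N}_0 .$$ Then $\{a_n\}_{n=0}^\infty$ can be interpolated by a polynomial if and only if $T$ is a finite order differential operator.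
   Context: $\mathbb{N}_0=\{0,1,2,\dots\}$ and $D=\frac{d}{dx}$. An operator $\sum_{k=0}^\infty Q_k(x)D^k$ with $Q_k\in\mathbb{R}[x]$ acts on $p\in\mathbb{R}[x]$ by $p\mapsto\sum_{k=0}^{\infty}Q_k(x)p^{(k)}(x)$, a finite sum since $p^{(k)}=0$ for $k>\deg p$. Such an operator is a finite order differential operator if $Q_k(x)\equiv 0$ for all but finitely many $k$ (the zero operator is counted as finite order); it is of infinite order if $Q_k(x)\not\equiv0$ for infinitely many $k$. A sequence of real numbers $\{a_n\}_{n=0}^\infty$ can be interpolated by a polynomial if there is a polynomial $p(x)$ with $a_n=p(n)$ for every $n\in\mathbb{N}_0$. *)

theory Defs
  imports "HOL-Computational_Algebra.Polynomial"
begin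

text \<open>
  A sequence \<open>Q\<close> of real polynomials encodes the operator with coefficient \<open>Q k\<close> at the
  \<open>k\<close>-th derivative. The formally infinite sum is cut off at the degree of the argument,
  beyond which all derivatives vanish (see \<open>diff_op_eq_sum\<close>).
\<close>

definition diff_op :: "(nat \<Rightarrow> real poly) \<Rightarrow> real poly \<Rightarrow> real poly" where
  "diff_op Q p = (\<Sum>k\<le>degree p. Q k * (pderiv ^^ k) p)"

definition finite_order :: "(nat \<Rightarrow> real poly) \<Rightarrow> bool" where
  "finite_order Q \<longleftrightarrow> finite {k. Q k \<noteq> 0}"

definition interpolated_by_poly :: "(nat \<Rightarrow> real) \<Rightarrow> bool" where
  "interpolated_by_poly a \<longleftrightarrow> (\<exists>p :: real poly. \<forall>n. a n = poly p (real n))"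

lemma degree_funpow_pderiv: "degree ((pderiv ^^ k) p) = degree p - k"
  for p :: "real poly"
  by (induction k) (simp_all add: degree_pderiv)

lemma funpow_pderiv_eq_0:
  fixes p :: "real poly"
  assumes "degree p < k"
  shows "(pderiv ^^ k) p = 0"
proof -
  have "pderiv ((pderiv ^^ degree p) p) = 0"
    by (simp add: pderiv_eq_0_iff degree_funpow_pderiv)
  then have *: "(pderiv ^^ Suc (degree p)) p = 0"
    by simp
  have "(pderiv ^^ j) (0 :: real poly) = 0" for j
    by (induction j) simp_all
  moreover have "k = (k - Suc (degree p)) + Suc (degree p)"
    using assms by simp
  ultimately show ?thesis
    using * by (metis funpow_add comp_apply)
qed

lemma diff_op_eq_sum:
  assumes "degree p \<le> N"
  shows "diff_op Q p = (\<Sum>k\<le>N. Q k * (pderiv ^^ k) p)"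
  unfolding diff_op_def
  using assms by (intro sum.mono_neutral_left) (auto simp: funpow_pderiv_eq_0)

end

theory Submission
  imports Defs
begin

text \<open>
  Both directions rest on triangularity: \<open>D\<^sup>n B\<^sub>n\<close> is a nonzero constant, so the value of an
  operator at \<open>B\<^sub>n\<close> determines its \<open>n\<close>-th coefficient from the earlier ones.

  If \<open>a\<^sub>n = p(n)\<close>, the operator \<open>p(W)\<close> has the same eigenvalues on the \<open>B\<^sub>n\<close> as \<open>T\<close>. It is of
  finite order, because finite order operators form an algebra: they are closed under sums,
  multiplication by polynomials and left composition with \<open>D\<close>. By triangularity the two operators
  have the same coefficients (\<open>diff_op_coeffs_unique\<close>), so \<open>T\<close> is of finite order.

  Conversely, since \<open>T\<close> does not raise the degree of any \<open>B\<^sub>n\<close>, triangularity forces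
  \<open>deg Q\<^sub>k \<le> k\<close> (\<open>degree_coeff_le\<close>). Comparing the coefficients of \<open>x\<^sup>n\<close> in \<open>T B\<^sub>n = a\<^sub>n B\<^sub>n\<close>
  then gives \<open>a\<^sub>n = (\<Sum>k. q\<^sub>k n(n-1)\<cdots>(n-k+1))\<close> with \<open>q\<^sub>k\<close> the coefficient of \<open>x\<^sup>k\<close> in \<open>Q\<^sub>k\<close>
  (\<open>eigenvalue_eq_sum\<close>). This is a polynomial in \<open>n\<close> as soon as \<open>T\<close> is of finite order.
\<close>

section \<open>The algebra of finite order operators\<close>

definition finite_order_op :: "(real poly \<Rightarrow> real poly) \<Rightarrow> bool" where
  "finite_order_op L \<longleftrightarrow> (\<exists>Q. finite_order Q \<and> L = diff_op Q)"

lemma finite_order_iff_bounded: "finite_order Q \<longleftrightarrow> (\<exists>N. \<forall>k>N. Q k = 0)"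
  unfolding finite_order_def finite_nat_set_iff_bounded_le
  by (auto simp: not_le [symmetric])

text \<open>
  For a finite order operator the range of summation can be chosen independently of the argument,
  which exhibits the operator itself as a sum of operators \<open>Q\<^sub>k D\<^sup>k\<close>.
\<close>

lemma diff_op_eq_sum_order:
  assumes "\<And>k. k > N \<Longrightarrow> Q k = 0"
  shows "diff_op Q p = (\<Sum>k\<le>N. Q k * (pderiv ^^ k) p)"
proof -
  have "diff_op Q p = (\<Sum>k\<le>max N (degree p). Q k * (pderiv ^^ k) p)"
    by (rule diff_op_eq_sum) simp
  also have "\<dots> = (\<Sum>k\<le>N. Q k * (pderiv ^^ k) p)"
    by (rule sum.mono_neutral_right) (auto simp: assms)
  finally show ?thesis .
qed

lemma finite_order_op_zero: "finite_order_op (\<lambda>p. 0)"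
  unfolding finite_order_op_def
  by (rule exI [of _ "\<lambda>_. 0"]) (auto simp: finite_order_def diff_op_def)

lemma finite_order_op_id: "finite_order_op (\<lambda>p. p)"
  unfolding finite_order_op_def
proof (intro exI conjI)
  let ?I = "\<lambda>k::nat. if k = 0 then 1 else 0 :: real poly"
  show "finite_order ?I"
    by (simp add: finite_order_def)
  have "diff_op ?I p = p" for p
    by (subst diff_op_eq_sum_order [of 0]) auto
  then show "(\<lambda>p. p) = diff_op ?I"
    by auto
qed

lemma finite_order_op_add:
  assumes "finite_order_op L" "finite_order_op M"
  shows "finite_order_op (\<lambda>p. L p + M p)"
proof -
  obtain Q R where Q: "finite_order Q" "L = diff_op Q" and R: "finite_order R" "M = diff_op R"
    using assms by (auto simp: finite_order_op_def)
  have "{k. Q k + R k \<noteq> 0} \<subseteq> {k. Q k \<noteq> 0} \<union> {k. R k \<noteq> 0}"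
    by auto
  then have "finite_order (\<lambda>k. Q k + R k)"
    using Q(1) R(1) unfolding finite_order_def by (auto intro: finite_subset)
  moreover have "(\<lambda>p. L p + M p) = diff_op (\<lambda>k. Q k + R k)"
    by (simp add: fun_eq_iff Q R diff_op_def distrib_right sum.distrib)
  ultimately show ?thesis
    unfolding finite_order_op_def by blast
qed

lemma finite_order_op_mult:
  assumes "finite_order_op L"
  shows "finite_order_op (\<lambda>p. q * L p)"
proof -
  obtain Q where Q: "finite_order Q" "L = diff_op Q"
    using assms by (auto simp: finite_order_op_def)
  have "finite_order (\<lambda>k. q * Q k)"
    using Q(1) unfolding finite_order_def by (rule rev_finite_subset) auto
  moreover have "(\<lambda>p. q * L p) = diff_op (\<lambda>k. q * Q k)"
    by (simp add: fun_eq_iff Q diff_op_def mult.assoc sum_distrib_left)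
  ultimately show ?thesis
    unfolding finite_order_op_def by blast
qed

text \<open>
  The Leibniz rule \<open>D \<circ> Q\<^sub>k D\<^sup>k = Q\<^sub>k' D\<^sup>k + Q\<^sub>k D\<^bsup>k+1\<^esup>\<close> shows that the coefficients of \<open>D \<circ> L\<close>
  are \<open>Q\<^sub>k' + Q\<^bsub>k-1\<^esub>\<close>.
\<close>

lemma finite_order_op_pderiv:
  assumes "finite_order_op L"
  shows "finite_order_op (\<lambda>p. pderiv (L p))"
proof -
  obtain Q where Q: "finite_order Q" "L = diff_op Q"
    using assms by (auto simp: finite_order_op_def)
  define R where "R k = pderiv (Q k) + (case k of 0 \<Rightarrow> 0 | Suc j \<Rightarrow> Q j)" for k
  obtain N where N: "\<And>k. k > N \<Longrightarrow> Q k = 0"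
    using Q(1) finite_order_iff_bounded by blast
  then have "R k = 0" if "k > Suc N" for k
    using that by (auto simp: R_def split: nat.split)
  then have "finite_order R"
    using finite_order_iff_bounded by blast
  moreover have "pderiv (L p) = diff_op R p" for p
  proof -
    let ?d = "degree p"
    let ?S = "\<Sum>k\<le>?d. Q k * (pderiv ^^ Suc k) p"
    \<comment> \<open>One summand beyond the degree makes the index shift in the second sum exact.\<close>
    have "diff_op R p = (\<Sum>k\<le>Suc ?d. R k * (pderiv ^^ k) p)"
      by (rule diff_op_eq_sum) simp
    also have "\<dots> = (\<Sum>k\<le>Suc ?d. pderiv (Q k) * (pderiv ^^ k) p) + ?S"
      by (simp only: R_def distrib_right sum.distrib
          sum.atMost_Suc_shift [of "\<lambda>k. (case k of 0 \<Rightarrow> 0 | Suc j \<Rightarrow> Q j) * (pderiv ^^ k) p"])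
        simp
    also have "(\<Sum>k\<le>Suc ?d. pderiv (Q k) * (pderiv ^^ k) p)
        = (\<Sum>k\<le>?d. pderiv (Q k) * (pderiv ^^ k) p)"
      using funpow_pderiv_eq_0 [of p "Suc ?d"] by simp
    also have "\<dots> + ?S = pderiv (L p)"
      by (simp add: Q(2) diff_op_def higher_pderiv_sum [of 1, simplified] pderiv_mult
          sum.distrib algebra_simps)
    finally show ?thesis ..
  qed
  ultimately show ?thesis
    unfolding finite_order_op_def by blast
qed

lemma finite_order_op_sum:
  assumes "\<And>i. i \<in> A \<Longrightarrow> finite_order_op (L i)"
  shows "finite_order_op (\<lambda>p. \<Sum>i\<in>A. L i p)"
  using assms
  by (induction A rule: infinite_finite_induct)
    (simp_all add: finite_order_op_zero finite_order_op_add)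

lemma finite_order_op_compose:
  assumes "finite_order_op L" "finite_order_op M"
  shows "finite_order_op (\<lambda>p. L (M p))"
proof -
  obtain Q where Q: "finite_order Q" "L = diff_op Q"
    using assms by (auto simp: finite_order_op_def)
  obtain N where "\<And>k. k > N \<Longrightarrow> Q k = 0"
    using Q(1) finite_order_iff_bounded by blast
  then have *: "L (M p) = (\<Sum>k\<le>N. Q k * (pderiv ^^ k) (M p))" for p
    unfolding Q(2) by (rule diff_op_eq_sum_order)
  have "finite_order_op (\<lambda>p. (pderiv ^^ k) (M p))" for k
    by (induction k) (simp_all add: assms finite_order_op_pderiv)
  then show ?thesis
    unfolding * by (intro finite_order_op_sum finite_order_op_mult)
qed

lemma diff_op_smult: "diff_op Q (smult c p) = smult c (diff_op Q p)"
proof -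
  have "(pderiv ^^ k) (smult c p) = smult c ((pderiv ^^ k) p)" for k
    by (induction k) (simp_all add: pderiv_smult)
  then have "diff_op Q (smult c p) = (\<Sum>k\<le>degree p. Q k * smult c ((pderiv ^^ k) p))"
    by (subst diff_op_eq_sum [of _ "degree p"]) (simp_all add: degree_smult_le)
  also have "\<dots> = smult c (diff_op Q p)"
    by (simp add: diff_op_def sum_distrib_left [of "[:c:]", simplified])
  finally show ?thesis .
qed

text \<open>
  The operator constructed here is \<open>p(W)\<close>, built from \<open>p\<close> by Horner's scheme.
\<close>

lemma finite_order_op_poly_eigenvalues:
  assumes W: "finite_order W" "\<And>n. diff_op W (B n) = smult (e n) (B n)"
  shows "\<exists>L. finite_order_op L \<and> (\<forall>n. L (B n) = smult (poly p (e n)) (B n))"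
proof (induction p)
  case 0
  show ?case
    using finite_order_op_zero by (intro exI [of _ "\<lambda>p. 0"]) simp
next
  case (pCons c p)
  then obtain L where L: "finite_order_op L" "\<And>n. L (B n) = smult (poly p (e n)) (B n)"
    by blast
  have "finite_order_op (diff_op W)"
    using W(1) finite_order_op_def by blast
  then have "finite_order_op (\<lambda>f. [:c:] * f + diff_op W (L f))"
    by (rule finite_order_op_add [OF finite_order_op_mult [OF finite_order_op_id]
          finite_order_op_compose [OF _ L(1)]])
  moreover have "[:c:] * B n + diff_op W (L (B n)) = smult (poly (pCons c p) (e n)) (B n)" for n
    by (simp add: L(2) W(2) diff_op_smult smult_add_left mult.commute)
  ultimately show ?case
    by (intro exI [of _ "\<lambda>f. [:c:] * f + diff_op W (L f)"]) simp
qed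

section \<open>Triangularity\<close>

lemma funpow_pderiv_degree_neq_0:
  fixes p :: "real poly"
  assumes "p \<noteq> 0"
  shows "(pderiv ^^ degree p) p \<noteq> 0"
proof
  assume "(pderiv ^^ degree p) p = 0"
  then have "coeff ((pderiv ^^ degree p) p) 0 = 0"
    by simp
  moreover have "pochhammer (1::real) (degree p) \<noteq> 0"
    by (metis pochhammer_fact fact_nonzero)
  ultimately show False
    using assms by (simp add: coeff_higher_pderiv)
qed

lemma diff_op_split_last:
  assumes "degree p = n"
  shows "diff_op Q p = (\<Sum>k<n. Q k * (pderiv ^^ k) p) + Q n * (pderiv ^^ n) p"
  by (simp add: diff_op_def assms flip: lessThan_Suc_atMost)

lemma diff_op_coeffs_unique:
  assumes B: "\<And>n. degree (B n) = n" "\<And>n. B n \<noteq> 0"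
    and eq: "\<And>n. diff_op Q (B n) = diff_op R (B n)"
  shows "Q = R"
proof
  show "Q n = R n" for n
  proof (induction n rule: less_induct)
    case (less n)
    then have "Q n * (pderiv ^^ n) (B n) = R n * (pderiv ^^ n) (B n)"
      using eq [of n] by (simp add: diff_op_split_last [OF B(1)])
    then show ?case
      using funpow_pderiv_degree_neq_0 [OF B(2), of n] by (simp add: B(1))
  qed
qed

text \<open>
  Inductively, \<open>Q\<^sub>k D\<^sup>k\<close> with \<open>k < n\<close> maps \<open>B\<^sub>n\<close> to a polynomial of degree at most
  \<open>k + (n - k) = n\<close>, so the remaining summand, a nonzero multiple of \<open>Q\<^sub>n\<close>, obeys this bound too.
\<close>

lemma degree_coeff_le:
  assumes B: "\<And>n. degree (B n) = n" "\<And>n. B n \<noteq> 0"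
    and le: "\<And>n. degree (diff_op Q (B n)) \<le> n"
  shows "degree (Q n) \<le> n"
proof (induction n rule: less_induct)
  case (less n)
  have "degree (Q k * (pderiv ^^ k) (B n)) \<le> n" if "k < n" for k
    using degree_mult_le [of "Q k" "(pderiv ^^ k) (B n)"] less [OF that] that
    by (simp add: degree_funpow_pderiv B(1))
  then have "degree (\<Sum>k<n. Q k * (pderiv ^^ k) (B n)) \<le> n"
    by (intro degree_sum_le) auto
  then have "degree (diff_op Q (B n) - (\<Sum>k<n. Q k * (pderiv ^^ k) (B n))) \<le> n"
    using le by (intro degree_diff_le)
  then have "degree (Q n * (pderiv ^^ n) (B n)) \<le> n"
    by (simp add: diff_op_split_last [OF B(1)])
  then show ?case
    using funpow_pderiv_degree_neq_0 [OF B(2), of n]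
    by (cases "Q n = 0") (simp_all add: degree_mult_eq degree_funpow_pderiv B(1))
qed

section \<open>Eigenvalues as polynomials in the index\<close>

lemma coeff_mult_degree_le:
  fixes p q :: "real poly"
  assumes "degree p \<le> m" "degree q \<le> n"
  shows "coeff (p * q) (m + n) = coeff p m * coeff q n"
proof (cases "degree p = m \<and> degree q = n")
  case True
  then show ?thesis
    using coeff_mult_degree_sum by blast
next
  case False
  then have "degree p + degree q < m + n" "coeff p m * coeff q n = 0"
    using assms by (auto simp: coeff_eq_0)
  then show ?thesis
    using degree_mult_le [of p q] by (simp add: coeff_eq_0)
qed

text \<open>
  The falling factorial \<open>n(n-1)\<cdots>(n-k+1)\<close> is the factor that \<open>D\<^sup>k\<close> puts on \<open>x\<^sup>n\<close>.
\<close>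

lemma pochhammer_eq_falling:
  assumes "k \<le> n"
  shows "pochhammer (real (Suc (n - k))) k = (\<Prod>i<k. real n - real i)"
proof -
  have "pochhammer (real (Suc (n - k))) k = (\<Prod>i<k. real n - real (k - Suc i))"
    unfolding pochhammer_prod atLeast0LessThan
    using assms by (intro prod.cong) (auto simp: of_nat_diff)
  also have "\<dots> = (\<Prod>i<k. real n - real i)"
    by (rule prod.nat_diff_reindex)
  finally show ?thesis .
qed

text \<open>
  As \<open>deg Q\<^sub>k \<le> k\<close>, only the leading term of \<open>B\<close> contributes to the coefficient of \<open>x\<^sup>n\<close> in
  \<open>Q\<^sub>k D\<^sup>k B\<close>.
\<close>

lemma eigenvalue_eq_sum:
  assumes B: "degree (B :: real poly) = n" "B \<noteq> 0"
    and eig: "diff_op Q B = smult c B"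
    and deg: "\<And>k. degree (Q k) \<le> k"
  shows "c = (\<Sum>k\<le>n. coeff (Q k) k * (\<Prod>i<k. real n - real i))"
proof -
  have lead: "coeff B n \<noteq> 0"
    using B by auto
  have term_coeff: "coeff (Q k * (pderiv ^^ k) B) n
      = coeff (Q k) k * (\<Prod>i<k. real n - real i) * coeff B n" if "k \<le> n" for k
    using coeff_mult_degree_le [OF deg [of k], of "(pderiv ^^ k) B" "n - k"] that
      pochhammer_eq_falling [OF that]
    by (simp add: degree_funpow_pderiv B(1) coeff_higher_pderiv)
  have "c * coeff B n = coeff (diff_op Q B) n"
    by (simp add: eig)
  also have "\<dots> = (\<Sum>k\<le>n. coeff (Q k) k * (\<Prod>i<k. real n - real i)) * coeff B n"
    by (simp add: diff_op_def B(1) coeff_sum term_coeff sum_distrib_right)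
  finally show ?thesis
    using lead by simp
qed

theorem theorem13:
  fixes B :: "nat \<Rightarrow> real poly" and a :: "nat \<Rightarrow> real" and Q :: "nat \<Rightarrow> real poly"
  assumes "\<And>n. degree (B n) = n" and "B 0 \<noteq> 0"
    and "\<exists>W. finite_order W \<and> (\<forall>n. diff_op W (B n) = smult (real n) (B n))"
    and "\<And>n. diff_op Q (B n) = smult (a n) (B n)"
  shows "interpolated_by_poly a \<longleftrightarrow> finite_order Q"
proof
  have B_neq_0: "B n \<noteq> 0" for n
    using assms(1) [of n] assms(2) by (cases "n = 0") auto
  {
    assume "interpolated_by_poly a"
    then obtain p where p: "\<And>n. a n = poly p (real n)"
      by (auto simp: interpolated_by_poly_def)
    obtain W where "finite_order W" "\<And>n. diff_op W (B n) = smult (real n) (B n)"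
      using assms(3) by blast
    then obtain L where L: "finite_order_op L" "\<And>n. L (B n) = smult (poly p (real n)) (B n)"
      using finite_order_op_poly_eigenvalues by blast
    obtain R where R: "finite_order R" "L = diff_op R"
      using L(1) finite_order_op_def by blast
    have "Q = R"
      using assms(1) B_neq_0
      by (rule diff_op_coeffs_unique) (simp add: assms(4) p L(2) flip: R(2))
    then show "finite_order Q"
      using R(1) by simp
  }
  {
    assume "finite_order Q"
    then obtain N where N: "\<And>k. k > N \<Longrightarrow> Q k = 0"
      using finite_order_iff_bounded by blast
    have deg: "degree (Q k) \<le> k" for k
      using assms(1) B_neq_0
      by (rule degree_coeff_le) (metis assms(1,4) degree_smult_le)
    define P where "P = (\<Sum>k\<le>N. smult (coeff (Q k) k) (\<Prod>i<k. [:- real i, 1:]))"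
    have "a n = poly P (real n)" for n
    proof -
      let ?t = "\<lambda>k. coeff (Q k) k * (\<Prod>i<k. real n - real i)"
      have "a n = (\<Sum>k\<le>n. ?t k)"
        using assms(1) B_neq_0 assms(4) deg by (rule eigenvalue_eq_sum)
      \<comment> \<open>The summands with \<open>k > n\<close> contain the factor \<open>n - n\<close>, those with \<open>k > N\<close> a zero
        coefficient, so the range of summation need not depend on \<open>n\<close>.\<close>
      also have "\<dots> = (\<Sum>k\<le>max n N. ?t k)"
        by (rule sum.mono_neutral_left) auto
      also have "\<dots> = (\<Sum>k\<le>N. ?t k)"
        by (rule sum.mono_neutral_right) (auto simp: N)
      also have "\<dots> = poly P (real n)"
        by (simp add: P_def poly_sum poly_prod)
      finally show ?thesis .
    qed
    then show "interpolated_by_poly a"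
      unfolding interpolated_by_poly_def by blast
  }
qed

end
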